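(* Let $\mathcal{T}$ be a class of tournaments. The following properties are equivalent: (i) $\mathcal{T}$ is $\vec{\chi}$-bounded. (ii) $\mathcal{T}^{\prec}$ is $\chi$-bounded. (iii) $\mathcal{T}^{\prec_{\vec{\omega}}}$ is $\chi$-bounded.
   Context: All graphs and digraphs are finite, with no loops, no parallel edges or arcs, and no anti-parallel arcs. A tournament is an orientation of a complete graph. A class of tournaments is a set of tournaments closed under taking subtournaments (and isomorphism). The dichromatic number $\vec{\chi}(D)$ of a digraph $D$ is the least $k$ such that $V(D)$ can be partitioned into $k$ sets each inducing an acyclic subdigraph. For a total ordering $\prec$ of $V(D)$, the backedge graph $D^{\prec}$ is the undirected graph with vertex set $V(D)$ in which, for $u\prec v$, $uv$ is an edge if and only if $vu\in A(D)$. The clique number of $D$ is $\vec{\omega}(D)=\min\{\omega(D^{\prec}) : \prec \text{ a total ordering of } V(D)\}$. An $\vec{\omega}$-ordering of $D$ is a total ordering $\prec$ of $V(D)$ with $\omega(D^{\prec})=\vec{\omega}(D)$. A class $\mathcal{C}$ of digraphs is $\vec{\chi}$-bounded if there is an increasing function $f$ with $\vec{\chi}(D)\le f(\vec{\omega}(D))$ for every $D\in\mathcal{C}$. A set $\mathcal{G}$ of undirected graphs is $\chi$-bounded if there is an increasing function $f$ with $\chi(G)\le f(\omega(G))$ for every $G\in\mathcal{G}$. $\mathcal{T}^{\prec}=\{T^{\prec} : T\in\mathcal{T},\ \prec \text{ a total ordering of } V(T)\}$ and $\mathcal{T}^{\prec_{\vec{\omega}}}=\{T^{\prec} : T\in\mathcal{T},\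 \prec \text{ an } \vec{\omega}\text{-ordering of } T\}$. *)

theory Defs
  imports "HOL-Library.Disjoint_Sets" "Graph_Theory.Graph_Theory"
begin

text \<open>
  Digraphs are the records \<^typ>\<open>'a pair_pre_digraph\<close> of \<^theory>\<open>Graph_Theory.Pair_Digraph\<close>, and,
  following that library, an undirected graph is a digraph with symmetric arc set
  (locale \<^locale>\<open>pair_graph\<close>). The null (di)graph is allowed.
\<close>

text \<open>\<^locale>\<open>pair_digraph\<close> gives finiteness and no loops, and excludes parallel arcs;
  asymmetry excludes anti-parallel arcs.\<close>

definition oriented_graph :: "'a pair_pre_digraph \<Rightarrow> bool" where
  "oriented_graph D \<longleftrightarrow> pair_digraph D \<and> asym (parcs D)"

definition tournament :: "'a pair_pre_digraph \<Rightarrow> bool" where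
  "tournament T \<longleftrightarrow> oriented_graph T \<and> complete_digraph (card (pverts T)) (mk_symmetric T)"

definition tournament_class :: "'a pair_pre_digraph set \<Rightarrow> bool" where
  "tournament_class \<T> \<longleftrightarrow>
     (\<forall>T\<in>\<T>. tournament T) \<and>
     (\<forall>T\<in>\<T>. \<forall>S. induced_subgraph (with_proj S) (with_proj T) \<longrightarrow> S \<in> \<T>) \<and>
     (\<forall>T\<in>\<T>. \<forall>S. digraph_iso (with_proj T) (with_proj S) \<longrightarrow> S \<in> \<T>)"

definition dichromatic_number :: "'a pair_pre_digraph \<Rightarrow> nat" where
  "dichromatic_number D =
     (LEAST k. \<exists>P. partition_on (pverts D) P \<and> card P = k \<and>
        (\<forall>X\<in>P. acyclic (arcs_ends (with_proj D \<restriction> X))))"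

definition chromatic_number :: "'a pair_pre_digraph \<Rightarrow> nat" where
  "chromatic_number G =
     (LEAST k. \<exists>c :: 'a \<Rightarrow> nat. c ` pverts G \<subseteq> {..<k} \<and> (\<forall>(u, v)\<in>parcs G. c u \<noteq> c v))"

definition clique :: "'a pair_pre_digraph \<Rightarrow> 'a set \<Rightarrow> bool" where
  "clique G K \<longleftrightarrow> K \<subseteq> pverts G \<and> (\<forall>u\<in>K. \<forall>v\<in>K. u \<noteq> v \<longrightarrow> (u, v) \<in> parcs G)"

definition clique_number :: "'a pair_pre_digraph \<Rightarrow> nat" where
  "clique_number G = Max (card ` {K. clique G K})"

text \<open>
  A total ordering of \<open>V(D)\<close> is a relation \<open>r\<close> with \<^prop>\<open>linear_order_on (pverts D) r\<close>. Such
  relations are reflexive, so \<open>u \<prec> v\<close> is \<open>(u, v) \<in> r - Id\<close>.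
\<close>

definition backedge_graph :: "'a pair_pre_digraph \<Rightarrow> 'a rel \<Rightarrow> 'a pair_pre_digraph" where
  "backedge_graph D r =
     \<lparr>pverts = pverts D,
      parcs = {(u, v). (u, v) \<in> r - Id \<and> (v, u) \<in> parcs D \<or>
                       (v, u) \<in> r - Id \<and> (u, v) \<in> parcs D}\<rparr>"

definition digraph_clique_number :: "'a pair_pre_digraph \<Rightarrow> nat" where
  "digraph_clique_number D =
     (INF r\<in>{r. linear_order_on (pverts D) r}. clique_number (backedge_graph D r))"

definition omega_ordering :: "'a pair_pre_digraph \<Rightarrow> 'a rel \<Rightarrow> bool" where
  "omega_ordering D r \<longleftrightarrow>
     linear_order_on (pverts D) r \<and>
     clique_number (backedge_graph D r) = digraph_clique_number D"

definition dichi_bounded :: "'a pair_pre_digraph set \<Rightarrow> bool" where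
  "dichi_bounded \<C> \<longleftrightarrow>
     (\<exists>f :: nat \<Rightarrow> nat. strict_mono f \<and>
        (\<forall>D\<in>\<C>. dichromatic_number D \<le> f (digraph_clique_number D)))"

definition chi_bounded :: "'a pair_pre_digraph set \<Rightarrow> bool" where
  "chi_bounded \<G> \<longleftrightarrow>
     (\<exists>f :: nat \<Rightarrow> nat. strict_mono f \<and>
        (\<forall>G\<in>\<G>. chromatic_number G \<le> f (clique_number G)))"

definition backedge_graphs :: "'a pair_pre_digraph set \<Rightarrow> 'a pair_pre_digraph set" where
  "backedge_graphs \<T> = {backedge_graph T r | T r. T \<in> \<T> \<and> linear_order_on (pverts T) r}"

definition omega_backedge_graphs :: "'a pair_pre_digraph set \<Rightarrow> 'a pair_pre_digraph set" where
  "omega_backedge_graphs \<T> = {backedge_graph T r | T r. T \<in> \<T> \<and> omega_ordering T r}"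

text \<open>Reading ``increasing'' as non-decreasing gives the same notions of boundedness.\<close>

lemma bounded_strict_mono_iff_mono:
  fixes a b :: "'b \<Rightarrow> nat"
  shows "(\<exists>f :: nat \<Rightarrow> nat. strict_mono f \<and> (\<forall>x\<in>A. a x \<le> f (b x))) \<longleftrightarrow>
         (\<exists>f :: nat \<Rightarrow> nat. mono f \<and> (\<forall>x\<in>A. a x \<le> f (b x)))"
proof
  assume "\<exists>f :: nat \<Rightarrow> nat. mono f \<and> (\<forall>x\<in>A. a x \<le> f (b x))"
  then obtain f :: "nat \<Rightarrow> nat" where f: "mono f" "\<forall>x\<in>A. a x \<le> f (b x)" by blast
  have "strict_mono (\<lambda>n. f n + n)"
    by (rule strict_monoI) (meson add_le_less_mono f(1) monoD less_imp_le)
  moreover have "\<forall>x\<in>A. a x \<le> f (b x) + b x" using f(2) by (auto intro: trans_le_add1)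
  ultimately show "\<exists>f :: nat \<Rightarrow> nat. strict_mono f \<and> (\<forall>x\<in>A. a x \<le> f (b x))" by blast
qed (blast intro: strict_mono_mono)

lemma parcs_mk_symmetric: "parcs (mk_symmetric (with_proj D)) = parcs D \<union> (parcs D)\<inverse>"
  unfolding mk_symmetric_def by force

lemma pverts_mk_symmetric: "pverts (mk_symmetric (with_proj D)) = pverts D"
  unfolding mk_symmetric_def by simp

lemma tournament_iff:
  "tournament T \<longleftrightarrow> finite (pverts T) \<and> parcs T \<subseteq> pverts T \<times> pverts T \<and>
     asym (parcs T) \<and> total_on (pverts T) (parcs T)"
  (is "?L \<longleftrightarrow> ?R")
proof
  assume L: ?L
  then interpret pair_digraph T by (simp add: tournament_def oriented_graph_def)
  have "parcs T \<union> (parcs T)\<inverse> = {(u, v). (u, v) \<in> pverts T \<times> pverts T \<and> u \<noteq> v}"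
    using L unfolding tournament_def complete_digraph_def
    by (simp add: parcs_mk_symmetric pverts_mk_symmetric)
  then have "total_on (pverts T) (parcs T)"
    unfolding total_on_def by blast
  moreover have "parcs T \<subseteq> pverts T \<times> pverts T" using wellformed' by auto
  ultimately show ?R
    using L pair_finite_verts by (simp add: tournament_def oriented_graph_def)
next
  assume R: ?R
  have irr: "(u, u) \<notin> parcs T" for u using R by (meson asymD)
  have fin: "finite (parcs T)" using R finite_subset by blast
  have D: "pair_digraph T"
    by unfold_locales (use R irr fin in auto)
  have arcs: "parcs T \<union> (parcs T)\<inverse> = {(u, v). (u, v) \<in> pverts T \<times> pverts T \<and> u \<noteq> v}"
    using R irr unfolding total_on_def by blast
  show ?L using D R
    unfolding tournament_def oriented_graph_def complete_digraph_pair_def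
      parcs_mk_symmetric pverts_mk_symmetric arcs by simp
qed

lemma pair_graph_backedge_graph:
  assumes "pair_digraph D"
  shows "pair_graph (backedge_graph D r)"
proof -
  interpret pair_digraph D by fact
  have "finite (parcs (backedge_graph D r))"
    by (rule finite_subset[of _ "pverts D \<times> pverts D"])
      (auto simp: backedge_graph_def wellformed')
  then show ?thesis
    by unfold_locales (auto simp: backedge_graph_def wellformed' symmetric_def sym_def)
qed

end

theory Submission
  imports Defs
begin

text \<open>
  Everything rests on comparing, for one tournament \<open>T\<close> and one ordering \<open>\<prec>\<close>, the dichromatic
  number of \<open>T\<close> with the chromatic number of its backedge graph \<open>G = T\<^sup>\<prec>\<close>.

  On an independent set of \<open>G\<close> all arcs of \<open>T\<close> go forward along \<open>\<prec>\<close>, so it is acyclic in \<open>T\<close>.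
  Hence the dichromatic number of \<open>T\<close> is at most \<open>\<chi>(G)\<close>
  (\<open>dichromatic_number_le_chromatic_number\<close>).

  Conversely, an acyclic set \<open>X\<close> of \<open>T\<close> induces a transitive tournament, so \<open>G[X]\<close> is the graph of
  the pairs on which two linear orders disagree: a permutation graph, which is perfect and so has a
  proper colouring with \<open>\<omega>(G)\<close> colours. Using disjoint palettes for the parts of an optimal
  partition into acyclic sets, \<open>\<chi>(G)\<close> is at most \<open>\<omega>(G)\<close> times the dichromatic number of \<open>T\<close>
  (\<open>chromatic_number_le_dichromatic_number_times_clique_number\<close>).

  If \<open>f\<close> bounds the dichromatic number of the class in terms of the clique number, then
  \<open>n \<mapsto> f n * n\<close> bounds the chromatic number of all backedge graphs, because \<open>\<omega>(G)\<close> is at least the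
  clique number of \<open>T\<close>. Such a bound applies in particular to the backedge graphs of optimal
  orderings; for these \<open>\<omega>(G)\<close> equals the clique number of \<open>T\<close>, and since every tournament has an
  optimal ordering, the first comparison bounds its dichromatic number by the same function.
\<close>

section \<open>Chromatic number and clique number of finite graphs\<close>

lemma chromatic_number_le_card:
  fixes c :: "'a \<Rightarrow> 'b"
  assumes "finite S" and "c ` pverts G \<subseteq> S" and "parcs G \<subseteq> pverts G \<times> pverts G"
    and "\<And>u v. (u, v) \<in> parcs G \<Longrightarrow> c u \<noteq> c v"
  shows "chromatic_number G \<le> card S"
proof -
  obtain g :: "'b \<Rightarrow> nat" where g: "bij_betw g S {0..<card S}"
    using ex_bij_betw_finite_nat[OF assms(1)] by blast
  have "(g \<circ> c) ` pverts G \<subseteq> {..<card S}"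
    using bij_betw_apply[OF g] assms(2) by (auto simp: image_subset_iff)
  moreover have "\<forall>(u, v)\<in>parcs G. (g \<circ> c) u \<noteq> (g \<circ> c) v"
  proof clarify
    fix u v assume uv: "(u, v) \<in> parcs G" and eq: "(g \<circ> c) u = (g \<circ> c) v"
    have "c u \<in> S" "c v \<in> S" using uv assms(2,3) by auto
    then have "c u = c v" using eq g by (auto simp: bij_betw_def dest: inj_onD)
    then show False using assms(4)[OF uv] by simp
  qed
  ultimately show ?thesis unfolding chromatic_number_def by (blast intro: Least_le)
qed

lemma optimal_colouring:
  assumes "pair_graph G"
  obtains c :: "'a \<Rightarrow> nat" where "c ` pverts G \<subseteq> {..<chromatic_number G}"
    and "\<forall>(u, v)\<in>parcs G. c u \<noteq> c v"
proof -
  interpret pair_graph G by fact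
  obtain g :: "'a \<Rightarrow> nat" where g: "bij_betw g (pverts G) {0..<card (pverts G)}"
    using ex_bij_betw_finite_nat[OF pair_finite_verts] by blast
  have "g u \<noteq> g v" if "(u, v) \<in> parcs G" for u v
    using that g wellformed'[OF that] no_loops'[OF that]
    by (auto simp: bij_betw_def dest: inj_onD)
  then have "\<exists>k. \<exists>c :: 'a \<Rightarrow> nat. c ` pverts G \<subseteq> {..<k} \<and> (\<forall>(u, v)\<in>parcs G. c u \<noteq> c v)"
    using g by (intro exI[of _ "card (pverts G)"] exI[of _ g]) (auto simp: bij_betw_def)
  then have "\<exists>c :: 'a \<Rightarrow> nat. c ` pverts G \<subseteq> {..<chromatic_number G} \<and>
      (\<forall>(u, v)\<in>parcs G. c u \<noteq> c v)"
    unfolding chromatic_number_def by (rule LeastI_ex)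
  then show thesis by (elim exE conjE) (rule that)
qed

lemma finite_cliques: "finite (pverts G) \<Longrightarrow> finite {K. clique G K}"
  by (rule finite_subset[of _ "Pow (pverts G)"]) (auto simp: clique_def)

lemma card_clique_le_clique_number:
  assumes "finite (pverts G)" and "clique G K"
  shows "card K \<le> clique_number G"
  unfolding clique_number_def using assms finite_cliques by (intro Max_ge) auto

section \<open>Acyclic sets of a tournament and its backedge graphs\<close>

lemma pair_digraph_tournament: "tournament T \<Longrightarrow> pair_digraph T"
  by (simp add: tournament_def oriented_graph_def)

lemma arcs_ends_restrict:
  "arcs_ends (with_proj D \<restriction> X) = {(u, v). (u, v) \<in> parcs D \<and> u \<in> X \<and> v \<in> X}"
  by (force simp: arcs_ends_def arc_to_ends_def)

text \<open>The arcs inside an independent set of the backedge graph are contained in the strict part of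
  the ordering, which is transitive and irreflexive.\<close>

lemma acyclic_if_independent_in_backedge_graph:
  assumes T: "pair_digraph T" and r: "linear_order_on (pverts T) r"
    and indep: "\<And>u v. u \<in> X \<Longrightarrow> v \<in> X \<Longrightarrow> (u, v) \<notin> parcs (backedge_graph T r)"
  shows "acyclic (arcs_ends (with_proj T \<restriction> X))"
proof -
  interpret pair_digraph T by fact
  have "trans (r - Id)"
    using r by (simp add: order_on_defs trans_diff_Id)
  then have "acyclic (r - Id)" by (simp add: acyclic_def trancl_id)
  moreover have "arcs_ends (with_proj T \<restriction> X) \<subseteq> r - Id"
  proof clarify
    fix u v assume "(u, v) \<in> arcs_ends (with_proj T \<restriction> X)"
    then have uv: "(u, v) \<in> parcs T" "u \<in> X" "v \<in> X" by (auto simp: arcs_ends_restrict)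
    have "u \<noteq> v" using no_loops'[OF uv(1)] .
    moreover have "(u, v) \<in> r \<or> (v, u) \<in> r"
      using r wellformed'[OF uv(1)] \<open>u \<noteq> v\<close> by (auto simp: order_on_defs total_on_def)
    moreover have "(v, u) \<notin> r"
      using indep[OF uv(2,3)] uv(1) \<open>u \<noteq> v\<close> by (auto simp: backedge_graph_def)
    ultimately show "(u, v) \<in> r - Id" by blast
  qed
  ultimately show ?thesis by (rule acyclic_subset)
qed

text \<open>The colour classes of an optimal colouring of the backedge graph are independent, hence acyclic.
  Besides the bound, this shows that a partition into acyclic sets exists, so that the minimum
  defining the dichromatic number is attained.\<close>

lemma acyclic_partition_from_backedge_graph:
  assumes T: "pair_digraph T" and r: "linear_order_on (pverts T) r"
  obtains P where "partition_on (pverts T) P"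
    and "\<forall>X\<in>P. acyclic (arcs_ends (with_proj T \<restriction> X))"
    and "card P \<le> chromatic_number (backedge_graph T r)"
proof -
  let ?G = "backedge_graph T r"
  obtain c :: "'a \<Rightarrow> nat" where "c ` pverts ?G \<subseteq> {..<chromatic_number ?G}"
    and proper: "\<forall>(u, v)\<in>parcs ?G. c u \<noteq> c v"
    by (rule optimal_colouring[OF pair_graph_backedge_graph[OF T, of r]])
  then have c: "c ` pverts T \<subseteq> {..<chromatic_number ?G}"
    by (simp add: backedge_graph_def)
  define colour_class where "colour_class i = {v \<in> pverts T. c v = i}" for i
  let ?P = "colour_class ` c ` pverts T"
  have "partition_on (pverts T) ?P"
    by (rule partition_onI) (auto simp: colour_class_def disjnt_def)
  moreover have "\<forall>X\<in>?P. acyclic (arcs_ends (with_proj T \<restriction> X))"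
    by (intro ballI acyclic_if_independent_in_backedge_graph[OF T r])
      (use proper in \<open>auto simp: colour_class_def\<close>)
  moreover have "card ?P \<le> chromatic_number ?G"
  proof -
    have fin: "finite (c ` pverts T)" using c by (rule finite_subset) simp
    have "card ?P \<le> card (c ` pverts T)" by (rule card_image_le[OF fin])
    also have "\<dots> \<le> chromatic_number ?G"
      using card_mono[OF _ c] by simp
    finally show ?thesis .
  qed
  ultimately show thesis by (rule that)
qed

lemma dichromatic_number_le_chromatic_number:
  assumes "pair_digraph T" and "linear_order_on (pverts T) r"
  shows "dichromatic_number T \<le> chromatic_number (backedge_graph T r)"
proof -
  obtain P where P: "partition_on (pverts T) P"
    "\<forall>X\<in>P. acyclic (arcs_ends (with_proj T \<restriction> X))"
    "card P \<le> chromatic_number (backedge_graph T r)"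
    by (rule acyclic_partition_from_backedge_graph[OF assms])
  have "dichromatic_number T \<le> card P"
    unfolding dichromatic_number_def by (rule Least_le) (use P in blast)
  with P(3) show ?thesis by simp
qed

lemma optimal_acyclic_partition:
  assumes "pair_digraph T" and "linear_order_on (pverts T) r"
  obtains P where "partition_on (pverts T) P" and "card P = dichromatic_number T"
    and "\<forall>X\<in>P. acyclic (arcs_ends (with_proj T \<restriction> X))"
proof -
  let ?Q = "\<lambda>k. \<exists>P. partition_on (pverts T) P \<and> card P = k \<and>
        (\<forall>X\<in>P. acyclic (arcs_ends (with_proj T \<restriction> X)))"
  have "\<exists>k. ?Q k" using acyclic_partition_from_backedge_graph[OF assms] by metis
  then have "?Q (dichromatic_number T)" unfolding dichromatic_number_def by (rule LeastI_ex)
  then show thesis using that by blast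
qed

lemma tournament_trans_on_acyclic:
  assumes T: "tournament T" and acyc: "acyclic (arcs_ends (with_proj T \<restriction> X))"
    and "u \<in> X" "v \<in> X" "w \<in> X" and uv: "(u, v) \<in> parcs T" and vw: "(v, w) \<in> parcs T"
  shows "(u, w) \<in> parcs T"
proof (rule ccontr)
  assume nuw: "(u, w) \<notin> parcs T"
  let ?A = "arcs_ends (with_proj T \<restriction> X)"
  have "(u, v) \<in> ?A" "(v, w) \<in> ?A" using assms by (auto simp: arcs_ends_restrict)
  then have uw: "(u, w) \<in> ?A\<^sup>+" by (meson trancl.simps)
  then have "u \<noteq> w" using acyc by (auto simp: acyclic_def)
  moreover have "u \<in> pverts T" "w \<in> pverts T" using T uv vw by (auto simp: tournament_iff)
  ultimately have "(w, u) \<in> parcs T"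
    using T nuw by (auto simp: tournament_iff total_on_def)
  then have "(w, u) \<in> ?A" using assms by (auto simp: arcs_ends_restrict)
  with uw have "(u, u) \<in> ?A\<^sup>+" by (rule trancl_into_trancl)
  then show False using acyc by (auto simp: acyclic_def)
qed

text \<open>
  Perfectness of permutation graphs, in the form needed here. A vertex is coloured with the largest
  size of a clique inside \<open>X\<close> that has this vertex as its last element. If \<open>u \<prec> v\<close> are adjacent,
  then \<open>v\<close> dominates \<open>u\<close>, which dominates every clique ending in \<open>u\<close>; by transitivity \<open>v\<close> can be
  appended to the clique, so the colour strictly increases along \<open>\<prec>\<close>.
\<close>

lemma colouring_of_acyclic_set:
  assumes T: "tournament T" and r: "linear_order_on (pverts T) r"
    and X: "X \<subseteq> pverts T" and acyc: "acyclic (arcs_ends (with_proj T \<restriction> X))"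
  obtains h :: "'a \<Rightarrow> nat"
    where "\<forall>v\<in>X. h v \<in> {1..clique_number (backedge_graph T r)}"
    and "\<forall>u\<in>X. \<forall>v\<in>X. (u, v) \<in> parcs (backedge_graph T r) \<longrightarrow> h u \<noteq> h v"
proof -
  let ?G = "backedge_graph T r"
  define C where "C v = {K. clique ?G K \<and> K \<subseteq> X \<and> v \<in> K \<and> (\<forall>w\<in>K. (w, v) \<in> r)}" for v
  define h where "h v = Max (card ` C v)" for v
  have V [simp]: "pverts ?G = pverts T" by (simp add: backedge_graph_def)
  have finV: "finite (pverts T)" using T by (simp add: tournament_iff)
  have finC: "finite (C v)" for v
    using finite_cliques[of ?G] finV
    by (intro finite_subset[of "C v" "{K. clique ?G K}"]) (auto simp: C_def)
  have singleton: "{v} \<in> C v" if "v \<in> X" for v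
    using that X r by (auto simp: C_def clique_def order_on_defs refl_on_def)
  have le_h: "card K \<le> h v" if "K \<in> C v" for K v
    unfolding h_def using that finC by (intro Max_ge) auto
  have attained: "\<exists>K\<in>C v. card K = h v" if "v \<in> X" for v
  proof -
    have "h v \<in> card ` C v"
      unfolding h_def using singleton[OF that] finC by (intro Max_in) auto
    then show ?thesis by force
  qed
  have range: "h v \<in> {1..clique_number ?G}" if v: "v \<in> X" for v
  proof -
    obtain K where "K \<in> C v" "card K = h v" using attained[OF v] by blast
    then have "h v \<le> clique_number ?G"
      using card_clique_le_clique_number[of ?G K] finV by (auto simp: C_def)
    moreover have "1 \<le> h v" using le_h[OF singleton[OF v]] by simp
    ultimately show ?thesis by simp
  qed
  have less: "h u < h v"
    if u: "u \<in> X" and v: "v \<in> X" and uv: "(u, v) \<in> r - Id" and vu: "(v, u) \<in> parcs T" for u v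
  proof -
    obtain K where K: "K \<in> C u" "card K = h u" using attained[OF u] by blast
    have tr: "trans r" and anti: "antisym r" and rf: "(v, v) \<in> r"
      using r X v by (auto simp: order_on_defs refl_on_def)
    have "v \<notin> K" using K(1) uv anti by (auto simp: C_def dest: antisymD)
    have before: "(w, v) \<in> r - Id" if "w \<in> K" for w
      using that K(1) uv tr \<open>v \<notin> K\<close> by (auto simp: C_def dest: transD)
    have dom: "(v, w) \<in> parcs T" if w: "w \<in> K" for w
    proof (cases "w = u")
      case False
      then have "(w, u) \<in> r" "(u, w) \<in> parcs ?G" "w \<in> X"
        using K(1) w by (auto simp: C_def clique_def)
      then have "(u, w) \<in> parcs T"
        using False anti by (auto simp: backedge_graph_def dest: antisymD)
      with tournament_trans_on_acyclic[OF T acyc v u \<open>w \<in> X\<close> vu] show ?thesis .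
    qed (use vu in simp)
    have "insert v K \<in> C v"
      using K(1) v X rf before dom by (auto simp: C_def clique_def backedge_graph_def)
    from le_h[OF this] have "card (insert v K) \<le> h v" .
    moreover have "finite K" using K(1) X finV by (auto simp: C_def intro: finite_subset)
    ultimately show ?thesis using K(2) \<open>v \<notin> K\<close> by simp
  qed
  show thesis
  proof (rule that[of h])
    show "\<forall>u\<in>X. \<forall>v\<in>X. (u, v) \<in> parcs ?G \<longrightarrow> h u \<noteq> h v"
      using less by (fastforce simp: backedge_graph_def)
  qed (use range in blast)
qed

text \<open>Colouring each vertex by its part together with its colour inside the part separates adjacent
  vertices of different parts by the first component, and those of a common part by the second.\<close>

lemma chromatic_number_le_dichromatic_number_times_clique_number:
  assumes T: "tournament T" and r: "linear_order_on (pverts T) r"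
  shows "chromatic_number (backedge_graph T r) \<le>
    dichromatic_number T * clique_number (backedge_graph T r)"
proof -
  let ?G = "backedge_graph T r"
  have D: "pair_digraph T" using T by (rule pair_digraph_tournament)
  obtain P where P: "partition_on (pverts T) P" "card P = dichromatic_number T"
    "\<forall>X\<in>P. acyclic (arcs_ends (with_proj T \<restriction> X))"
    by (rule optimal_acyclic_partition[OF D r])
  have union: "\<Union>P = pverts T" using P(1) by (simp add: partition_on_def)
  have "\<exists>h :: 'a \<Rightarrow> nat. (\<forall>v\<in>X. h v \<in> {1..clique_number ?G}) \<and>
      (\<forall>u\<in>X. \<forall>v\<in>X. (u, v) \<in> parcs ?G \<longrightarrow> h u \<noteq> h v)" if "X \<in> P" for X
  proof -
    have "X \<subseteq> pverts T" and "acyclic (arcs_ends (with_proj T \<restriction> X))"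
      using that union P(3) by blast+
    then show ?thesis by (rule colouring_of_acyclic_set[OF T r]) blast
  qed
  then obtain h :: "'a set \<Rightarrow> 'a \<Rightarrow> nat"
    where h: "\<And>X v. X \<in> P \<Longrightarrow> v \<in> X \<Longrightarrow> h X v \<in> {1..clique_number ?G}"
      "\<And>X u v. X \<in> P \<Longrightarrow> u \<in> X \<Longrightarrow> v \<in> X \<Longrightarrow> (u, v) \<in> parcs ?G \<Longrightarrow> h X u \<noteq> h X v"
    by metis
  have "\<forall>v\<in>pverts T. \<exists>X. X \<in> P \<and> v \<in> X" using union by blast
  then obtain part where part: "\<And>v. v \<in> pverts T \<Longrightarrow> part v \<in> P \<and> v \<in> part v"
    by metis
  have arcs: "parcs ?G \<subseteq> pverts T \<times> pverts T"
    using T by (auto simp: backedge_graph_def tournament_iff)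
  have "finite P"
    using finite_elements[OF _ P(1)] T by (simp add: tournament_iff)
  then have "chromatic_number ?G \<le> card (P \<times> {1..clique_number ?G})"
  proof (intro chromatic_number_le_card[where c = "\<lambda>v. (part v, h (part v) v)"])
    show "(\<lambda>v. (part v, h (part v) v)) ` pverts ?G \<subseteq> P \<times> {1..clique_number ?G}"
      using part h(1) by (fastforce simp: backedge_graph_def)
    show "parcs ?G \<subseteq> pverts ?G \<times> pverts ?G" using arcs by (simp add: backedge_graph_def)
    show "(part u, h (part u) u) \<noteq> (part v, h (part v) v)" if uv: "(u, v) \<in> parcs ?G" for u v
      using h(2)[of "part u" u v] part[of u] part[of v] uv arcs by auto
  qed simp
  also have "\<dots> = dichromatic_number T * clique_number ?G"
    using P(2) by (simp add: card_cartesian_product)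
  finally show ?thesis .
qed

section \<open>Orderings attaining the clique number\<close>

lemma digraph_clique_number_le:
  assumes "linear_order_on (pverts D) r"
  shows "digraph_clique_number D \<le> clique_number (backedge_graph D r)"
  unfolding digraph_clique_number_def using assms by (intro cINF_lower) auto

lemma omega_ordering_exists: "\<exists>r. omega_ordering D r"
proof -
  let ?w = "\<lambda>r. clique_number (backedge_graph D r)"
  obtain r0 where "well_order_on (pverts D) r0" using well_order_on by blast
  then have "?w ` {r. linear_order_on (pverts D) r} \<noteq> {}"
    by (auto simp: well_order_on_def)
  then have "digraph_clique_number D \<in> ?w ` {r. linear_order_on (pverts D) r}"
    unfolding digraph_clique_number_def by (rule Inf_nat_def1)
  then show ?thesis by (auto simp: omega_ordering_def)
qed

section \<open>Equivalence of the three kinds of boundedness\<close>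

lemma chi_bounded_backedge_graphs_if_dichi_bounded:
  assumes tour: "\<And>T. T \<in> \<T> \<Longrightarrow> tournament T" and "dichi_bounded \<T>"
  shows "chi_bounded (backedge_graphs \<T>)"
proof -
  obtain f :: "nat \<Rightarrow> nat" where f: "strict_mono f"
    and bound: "\<And>T. T \<in> \<T> \<Longrightarrow> dichromatic_number T \<le> f (digraph_clique_number T)"
    using assms(2) by (auto simp: dichi_bounded_def)
  have mono: "mono f" using f by (rule strict_mono_mono)
  have "mono (\<lambda>n. f n * n)" using mono by (intro monoI mult_le_mono) (auto dest: monoD)
  moreover have "chromatic_number G \<le> f (clique_number G) * clique_number G"
    if G_in: "G \<in> backedge_graphs \<T>" for G
  proof -
    obtain T r where G: "G = backedge_graph T r" and T: "T \<in> \<T>"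
      and r: "linear_order_on (pverts T) r"
      using G_in unfolding backedge_graphs_def by blast
    have "dichromatic_number T \<le> f (clique_number G)"
      using bound[OF T] monoD[OF mono digraph_clique_number_le[OF r]] G by simp
    then have "dichromatic_number T * clique_number G \<le> f (clique_number G) * clique_number G"
      by (rule mult_le_mono1)
    with chromatic_number_le_dichromatic_number_times_clique_number[OF tour[OF T] r]
    show ?thesis unfolding G by (rule le_trans)
  qed
  ultimately show ?thesis
    unfolding chi_bounded_def bounded_strict_mono_iff_mono by blast
qed

lemma chi_bounded_subset:
  "chi_bounded \<H> \<Longrightarrow> \<G> \<subseteq> \<H> \<Longrightarrow> chi_bounded \<G>"
  unfolding chi_bounded_def by blast

lemma dichi_bounded_if_chi_bounded_omega_backedge_graphs:
  assumes digraph: "\<And>D. D \<in> \<C> \<Longrightarrow> pair_digraph D" and "chi_bounded (omega_backedge_graphs \<C>)"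
  shows "dichi_bounded \<C>"
proof -
  obtain f :: "nat \<Rightarrow> nat" where f: "strict_mono f"
    and bound: "\<And>G. G \<in> omega_backedge_graphs \<C> \<Longrightarrow> chromatic_number G \<le> f (clique_number G)"
    using assms(2) by (auto simp: chi_bounded_def)
  have "dichromatic_number D \<le> f (digraph_clique_number D)" if D: "D \<in> \<C>" for D
  proof -
    obtain r where r: "omega_ordering D r" using omega_ordering_exists by blast
    have "dichromatic_number D \<le> chromatic_number (backedge_graph D r)"
      using dichromatic_number_le_chromatic_number[OF digraph[OF D]] r
      by (simp add: omega_ordering_def)
    also have "\<dots> \<le> f (clique_number (backedge_graph D r))"
      using D r by (intro bound) (auto simp: omega_backedge_graphs_def)
    finally show ?thesis using r by (simp add: omega_ordering_def)
  qed
  with f show ?thesis unfolding dichi_bounded_def by blast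
qed

theorem theorem3p6:
  fixes \<T> :: "'a pair_pre_digraph set"
  assumes "tournament_class \<T>"
  shows "(dichi_bounded \<T> \<longleftrightarrow> chi_bounded (backedge_graphs \<T>)) \<and>
         (chi_bounded (backedge_graphs \<T>) \<longleftrightarrow> chi_bounded (omega_backedge_graphs \<T>))"
proof -
  have tour: "tournament T" if "T \<in> \<T>" for T
    using assms that unfolding tournament_class_def by blast
  have "omega_backedge_graphs \<T> \<subseteq> backedge_graphs \<T>"
    by (auto simp: omega_backedge_graphs_def backedge_graphs_def omega_ordering_def)
  then have "chi_bounded (backedge_graphs \<T>) \<Longrightarrow> chi_bounded (omega_backedge_graphs \<T>)"
    using chi_bounded_subset by blast
  moreover have "dichi_bounded \<T> \<Longrightarrow> chi_bounded (backedge_graphs \<T>)"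
    using chi_bounded_backedge_graphs_if_dichi_bounded tour by blast
  moreover have "chi_bounded (omega_backedge_graphs \<T>) \<Longrightarrow> dichi_bounded \<T>"
    using dichi_bounded_if_chi_bounded_omega_backedge_graphs tour pair_digraph_tournament by blast
  ultimately show ?thesis by blast
qed

end
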